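(* Let $G$ be a finite group and $p$ be the smallest prime dividing $|G|$. If $|G'|\le p^2$, then every element of $G'$ is a commutator.
   Context: $G'$ is the commutator subgroup of $G$. A commutator is an element of the form $[x,y]=xyx^{-1}y^{-1}$ with $x,y\in G$. *)

theory Defs
  imports "HOL-Algebra.Algebra"
begin

text \<open>
  The library constant \<open>derived G H\<close> is the subgroup generated by the elements
  \<open>x \<otimes> y \<otimes> inv x \<otimes> inv y\<close> with \<open>x, y \<in> H\<close>, so \<open>G'\<close> is \<open>derived G (carrier G)\<close>.
  HOL-Algebra has its own constant \<open>prime\<close> for monoids; primality of natural numbers is
  therefore written \<open>Factorial_Ring.prime\<close>.
\<close>

definition commutator :: "('a, 'b) monoid_scheme \<Rightarrow> 'a \<Rightarrow> 'a \<Rightarrow> 'a" where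
  "commutator G x y = x \<otimes>\<^bsub>G\<^esub> y \<otimes>\<^bsub>G\<^esub> inv\<^bsub>G\<^esub> x \<otimes>\<^bsub>G\<^esub> inv\<^bsub>G\<^esub> y"

end

theory Submission
  imports Defs
begin

text \<open>
  Write \<open>[a, S]\<close> for the set of all \<open>[a, x]\<close> with \<open>x \<in> S\<close>. The proof gives more than is
  asked: a single \<open>a\<close> satisfies \<open>[a, G] = G'\<close>. Every prime factor of \<open>|G'|\<close> is at
  least \<open>p\<close>, so \<open>|G'|\<close> is \<open>1\<close>, a prime or \<open>p\<^sup>2\<close>; in each case \<open>G'\<close> is abelian. The identity
  \<open>[a, x y] = [a, x] (x [a, y] x\<inverse>)\<close> shows that \<open>[a, _]\<close> is multiplicative on \<open>G\<close>
  if \<open>G'\<close> is central, and in general multiplicative on the abelian group \<open>G'\<close>; hence \<open>[a, G]\<close>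
  (respectively \<open>[a, G']\<close>) is a subgroup. If \<open>|G'|\<close> is prime, a nontrivial such subgroup is
  already \<open>G'\<close>.

  Let \<open>|G'| = p\<^sup>2\<close> and suppose that \<open>[a, G] \<noteq> G'\<close> for all \<open>a\<close>. It is then enough to place all
  commutators in one subgroup of order \<open>p\<close>, which is absurd. If \<open>G'\<close> is central, two
  different nontrivial subgroups \<open>[a, G]\<close> and \<open>[b, G]\<close> would make \<open>G\<close> the union of two proper
  subgroups, the centralizers of \<open>a\<close> and \<open>b\<close> (lemma \<open>not_central\<close>). Otherwise let
  \<open>C\<close> be the centralizer of \<open>G'\<close>. For \<open>a \<notin> C\<close> the group \<open>[a, G']\<close> has order \<open>p\<close>, and
  a count with the size of the conjugacy class gives \<open>[a, G] = [a, G']\<close> (lemma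
  \<open>commutators_eq_A\<close>). This subgroup is normal, and a normal subgroup whose order is the
  prime \<open>p\<close> is central because \<open>G\<close> has no conjugacy class of size strictly between \<open>1\<close> and
  \<open>p\<close> (lemma \<open>A_central\<close>). Two different such subgroups would generate \<open>G'\<close> and
  make it central, so all of them coincide (lemma \<open>A_unique\<close>); the common subgroup
  then contains every commutator.
\<close>

section \<open>Commutator identities\<close>

context group
begin

lemma inv_cancel_left:
  assumes "x \<in> carrier G" "y \<in> carrier G"
  shows "x \<otimes> (inv x \<otimes> y) = y" "inv x \<otimes> (x \<otimes> y) = y"
  using assms by (simp_all add: m_assoc[symmetric])

lemmas group_word_simps = commutator_def m_assoc inv_mult_group inv_cancel_left

lemma commutator_closed [simp]:
  assumes "x \<in> carrier G" "y \<in> carrier G"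
  shows "commutator G x y \<in> carrier G"
  using assms by (simp add: commutator_def)

lemma commutator_mult_right:
  assumes "a \<in> carrier G" "x \<in> carrier G" "y \<in> carrier G"
  shows "commutator G a (x \<otimes> y) = commutator G a x \<otimes> (x \<otimes> commutator G a y \<otimes> inv x)"
  using assms by (simp add: group_word_simps)

lemma commutator_mult_left:
  assumes "a \<in> carrier G" "b \<in> carrier G" "x \<in> carrier G"
  shows "commutator G (a \<otimes> b) x = (a \<otimes> commutator G b x \<otimes> inv a) \<otimes> commutator G a x"
  using assms by (simp add: group_word_simps)

lemma conj_commutator:
  assumes "z \<in> carrier G" "a \<in> carrier G" "x \<in> carrier G"
  shows "z \<otimes> commutator G a x \<otimes> inv z = commutator G (z \<otimes> a \<otimes> inv z) (z \<otimes> x \<otimes> inv z)"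
  using assms by (simp add: group_word_simps)

lemma inv_commutator:
  assumes "a \<in> carrier G" "x \<in> carrier G"
  shows "inv (commutator G a x) = commutator G x a"
  using assms by (simp add: group_word_simps)

lemma conj_eq_self_iff:
  assumes "a \<in> carrier G" "x \<in> carrier G"
  shows "a \<otimes> x \<otimes> inv a = x \<longleftrightarrow> a \<otimes> x = x \<otimes> a"
  using assms by (metis inv_solve_right m_closed)

lemma commutator_eq_one_iff:
  assumes "a \<in> carrier G" "x \<in> carrier G"
  shows "commutator G a x = \<one> \<longleftrightarrow> a \<otimes> x = x \<otimes> a"
  unfolding commutator_def using assms conj_eq_self_iff
  by (metis inv_closed inv_equality inv_inv m_closed r_inv)

lemma commutator_in_derived:
  assumes "a \<in> carrier G" "x \<in> carrier G"
  shows "commutator G a x \<in> derived G (carrier G)"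
  unfolding derived_def commutator_def
  by (rule generate.incl) (use assms in blast)

lemma derived_subset_of_commutators:
  assumes "subgroup H G"
    and "\<And>x y. x \<in> carrier G \<Longrightarrow> y \<in> carrier G \<Longrightarrow> commutator G x y \<in> H"
  shows "derived G (carrier G) \<subseteq> H"
  unfolding derived_def
  by (rule generate_subgroup_incl[OF _ assms(1)])
    (use assms(2) in \<open>auto simp: commutator_def\<close>)

section \<open>Centralizers and subgroups of small order\<close>

text \<open>The elements of the group that commute with every element of \<open>S\<close>. The centre is
  \<open>centralizer (carrier G)\<close>.\<close>

definition centralizer :: "'a set \<Rightarrow> 'a set" where
  "centralizer S = {g \<in> carrier G. \<forall>s\<in>S. g \<otimes> s = s \<otimes> g}"

lemma centralizerD:
  assumes "g \<in> centralizer S" "s \<in> S"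
  shows "g \<otimes> s = s \<otimes> g"
  using assms unfolding centralizer_def by blast

lemma centralizer_subgroup:
  assumes "S \<subseteq> carrier G"
  shows "subgroup (centralizer S) G"
proof (rule subgroupI)
  show "centralizer S \<subseteq> carrier G" by (auto simp: centralizer_def)
  show "centralizer S \<noteq> {}"
    using assms by (auto simp: centralizer_def intro!: exI[of _ \<one>])
next
  fix g assume g: "g \<in> centralizer S"
  have "inv g \<otimes> s = s \<otimes> inv g" if "s \<in> S" for s
  proof -
    have s: "s \<in> carrier G" and gc: "g \<in> carrier G" and gs: "g \<otimes> s = s \<otimes> g"
      using that assms g by (auto simp: centralizer_def)
    have "inv g \<otimes> (g \<otimes> s) \<otimes> inv g = inv g \<otimes> (s \<otimes> g) \<otimes> inv g" using gs by simp
    thus ?thesis using s gc by (simp add: m_assoc inv_cancel_left)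
  qed
  thus "inv g \<in> centralizer S" using g by (auto simp: centralizer_def)
next
  fix g h assume gh: "g \<in> centralizer S" "h \<in> centralizer S"
  have "g \<otimes> h \<otimes> s = s \<otimes> (g \<otimes> h)" if "s \<in> S" for s
  proof -
    have c: "s \<in> carrier G" "g \<in> carrier G" "h \<in> carrier G" "g \<otimes> s = s \<otimes> g" "h \<otimes> s = s \<otimes> h"
      using that assms gh by (auto simp: centralizer_def)
    have "g \<otimes> h \<otimes> s = g \<otimes> s \<otimes> h" using c by (metis m_assoc)
    thus ?thesis using c by (metis m_assoc)
  qed
  thus "g \<otimes> h \<in> centralizer S" using gh by (auto simp: centralizer_def)
qed

lemma card_subgroup_dvd:
  assumes "subgroup H G" "subgroup K G" "H \<subseteq> K"
  shows "card H dvd card K"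
proof -
  interpret K: group "G\<lparr>carrier := K\<rparr>"
    using assms(2) by (rule subgroup.subgroup_is_group) (rule is_group)
  have "subgroup H (G\<lparr>carrier := K\<rparr>)" using assms by (simp add: subgroup_incl)
  from K.lagrange[OF this] have "card (rcosets\<^bsub>G\<lparr>carrier := K\<rparr>\<^esub> H) * card H = card K"
    by (simp add: order_def)
  thus ?thesis by (metis dvd_triv_right)
qed

lemma subgroup_of_prime_card:
  assumes "subgroup H G" "subgroup K G" "H \<subseteq> K" "Factorial_Ring.prime (card K)"
    and "h \<in> H" "h \<noteq> \<one>"
  shows "H = K"
proof -
  have fin: "finite K"
    using assms(4) by (metis card.infinite not_prime_0)
  have "card H \<noteq> 1"
    using assms(5,6) subgroup.one_closed[OF assms(1)] by (metis card_1_singletonE singletonD)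
  hence "card H = card K"
    using card_subgroup_dvd[OF assms(1-3)] assms(4) by (metis prime_nat_iff)
  thus ?thesis using fin assms(3) by (simp add: card_subset_eq)
qed

lemma commute_if_prime_card:
  assumes "subgroup K G" "Factorial_Ring.prime (card K)" "x \<in> K" "y \<in> K"
  shows "x \<otimes> y = y \<otimes> x"
proof (cases "x = \<one>")
  case True
  have "y \<in> carrier G" using assms(1,4) by (rule subgroup.mem_carrier)
  thus ?thesis using True by simp
next
  case False
  have xc: "x \<in> carrier G" using assms(1,3) subgroup.subset by blast
  have "subgroup (centralizer {x} \<inter> K) G"
    using centralizer_subgroup[of "{x}"] xc assms(1) by (simp add: subgroups_Inter_pair)
  hence "centralizer {x} \<inter> K = K"
    by (rule subgroup_of_prime_card[of _ _ x])
      (use assms xc False in \<open>auto simp: centralizer_def\<close>)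
  hence "y \<in> centralizer {x}" using assms(4) by blast
  from centralizerD[OF this, of x] show ?thesis by simp
qed

section \<open>Conjugacy classes\<close>

text \<open>The conjugacy class of an element, written as an image of the carrier.\<close>

definition conj_class :: "'a \<Rightarrow> 'a set" where
  "conj_class x = (\<lambda>g. g \<otimes> x \<otimes> inv g) ` carrier G"

lemma conj_class_eq_orbit:
  assumes "x \<in> carrier G"
  shows "conj_class x = orbit G (\<lambda>g. \<lambda>h \<in> carrier G. g \<otimes> h \<otimes> inv g) x"
  using assms by (auto simp: conj_class_def orbit_def)

lemma card_conj_class_dvd:
  assumes "x \<in> carrier G"
  shows "card (conj_class x) dvd order G"
  unfolding conj_class_eq_orbit[OF assms]
  by (rule dvdI[OF group_action.orbit_stabilizer_theorem[OF action_by_conjugation assms, symmetric]])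

lemma self_in_conj_class:
  assumes "x \<in> carrier G"
  shows "x \<in> conj_class x"
  using assms by (auto simp: conj_class_def intro!: image_eqI[of _ _ \<one>])

lemma central_if_card_conj_class_one:
  assumes "x \<in> carrier G" "card (conj_class x) = 1"
  shows "x \<in> centralizer (carrier G)"
proof -
  have *: "conj_class x = {x}"
    using assms self_in_conj_class by (metis card_1_singletonE singletonD)
  have "g \<otimes> x = x \<otimes> g" if "g \<in> carrier G" for g
  proof -
    have "g \<otimes> x \<otimes> inv g = x" using * that by (auto simp: conj_class_def)
    thus ?thesis using that assms conj_eq_self_iff by blast
  qed
  thus ?thesis using assms by (auto simp: centralizer_def)
qed

text \<open>By the class equation, the centre of a group of order \<open>p\<^sup>2\<close> is not trivial; the
  centralizer of a noncentral element would then lie strictly between the centre and the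
  whole group.\<close>

lemma commute_if_order_prime_square:
  assumes p: "Factorial_Ring.prime (p::nat)" and ord: "order G = p ^ 2"
    and x: "x \<in> carrier G" and y: "y \<in> carrier G"
  shows "x \<otimes> y = y \<otimes> x"
proof -
  let ?Z = "centralizer (carrier G)"
  let ?\<phi> = "\<lambda>g. \<lambda>h \<in> carrier G. g \<otimes> h \<otimes> inv g"
  let ?O = "orbits G (carrier G) ?\<phi>"
  interpret act: group_action G "carrier G" ?\<phi> by (rule action_by_conjugation)
  have p2: "p \<ge> 2" using p by (rule prime_ge_2_nat)
  have fin: "finite (carrier G)"
    using ord p2 order_gt_0_iff_finite by simp
  have O_eq: "?O = conj_class ` carrier G"
    by (auto simp: orbits_def conj_class_eq_orbit)
  have finO: "finite ?O" using O_eq fin by simp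
  have Zsub: "subgroup ?Z G" by (rule centralizer_subgroup) simp
  have "\<exists>z\<in>?Z. z \<noteq> \<one>"
  proof (rule ccontr)
    assume triv: "\<not> (\<exists>z\<in>?Z. z \<noteq> \<one>)"
    have cl1: "conj_class \<one> = {\<one>}" by (auto simp: conj_class_def intro!: exI[of _ \<one>])
    have one_O: "{\<one>} \<in> ?O" unfolding O_eq cl1[symmetric] by simp
    have "p dvd card c" if c: "c \<in> ?O - {{\<one>}}" for c
    proof -
      obtain t where t: "t \<in> carrier G" "c = conj_class t" using c O_eq by blast
      have "card c \<noteq> 1"
      proof
        assume "card c = 1"
        hence "t = \<one>" using central_if_card_conj_class_one t triv by blast
        thus False using c t cl1 by simp
      qed
      moreover have "card c dvd p ^ 2" using card_conj_class_dvd t ord by metis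
      then obtain i where "card c = p ^ i" using divides_primepow_nat[OF p] by blast
      ultimately show ?thesis by (cases i) auto
    qed
    hence rest: "p dvd (\<Sum>c\<in>?O - {{\<one>}}. card c)" by (rule dvd_sum)
    have "(\<Sum>c\<in>?O. card c) = p ^ 2"
      using act.disjoint_sum[OF fin, of "\<lambda>_. 1::nat"] ord by (simp add: order_def)
    hence "(\<Sum>c\<in>?O - {{\<one>}}. card c) + 1 = p ^ 2"
      using sum.remove[OF finO one_O, of card] by simp
    moreover have "p dvd p ^ 2" by simp
    ultimately have "p dvd (\<Sum>c\<in>?O - {{\<one>}}. card c) + 1" by simp
    hence "p dvd 1" using rest dvd_add_right_iff by blast
    thus False using p2 by simp
  qed
  then obtain z where z: "z \<in> ?Z" "z \<noteq> \<one>" by blast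
  let ?C = "centralizer {x}"
  have Csub: "subgroup ?C G" by (rule centralizer_subgroup) (use x in simp)
  have ZC: "?Z \<subseteq> ?C" using x by (auto simp: centralizer_def)
  have Cle: "?C \<subseteq> carrier G" by (auto simp: centralizer_def)
  have xC: "x \<in> ?C" using x by (auto simp: centralizer_def)
  have "card ?C dvd p ^ 2"
    using card_subgroup_dvd[OF Csub subgroup_self Cle] ord by (simp add: order_def)
  then obtain i where i: "i \<le> 2" "card ?C = p ^ i"
    using divides_primepow_nat[OF p] by blast
  consider "i = 0" | "i = 1" | "i = 2" using i by linarith
  hence "y \<in> ?C \<or> x \<in> ?Z"
  proof cases
    case 1
    hence "card ?C = 1" using i by simp
    hence "z = \<one>" using z ZC subgroup.one_closed[OF Csub] by (metis card_1_singletonE singletonD subsetD)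
    thus ?thesis using z by simp
  next
    case 2
    hence "?Z = ?C"
      using subgroup_of_prime_card[OF Zsub Csub ZC _ z] i p by simp
    thus ?thesis using xC by simp
  next
    case 3
    hence "?C = carrier G" using i ord Cle fin by (simp add: card_subset_eq order_def)
    thus ?thesis using y by simp
  qed
  thus ?thesis
    using centralizerD[of y "{x}" x] centralizerD[of x "carrier G" y] y by auto
qed

section \<open>The commutators with one fixed entry\<close>

lemma commutator_image_subgroup:
  assumes "a \<in> carrier G" "subgroup H G"
    and mult: "\<And>x y. x \<in> H \<Longrightarrow> y \<in> H \<Longrightarrow>
      commutator G a (x \<otimes> y) = commutator G a x \<otimes> commutator G a y"
  shows "subgroup (commutator G a ` H) G"
proof -
  interpret H: group "G\<lparr>carrier := H\<rparr>"
    using assms(2) by (rule subgroup.subgroup_is_group) (rule is_group)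
  have Hc: "H \<subseteq> carrier G" using assms(2) subgroup.subset by blast
  interpret group_hom "G\<lparr>carrier := H\<rparr>" G "commutator G a"
    by unfold_locales (use assms Hc in \<open>auto simp: hom_def\<close>)
  show ?thesis using img_is_subgroup by simp
qed

text \<open>Left translation by \<open>a\<close> maps the conjugacy class of \<open>inv a\<close> onto \<open>[a, G]\<close>.\<close>

lemma card_commutators_dvd:
  assumes a: "a \<in> carrier G"
  shows "card (commutator G a ` carrier G) dvd order G"
proof -
  have "commutator G a ` carrier G = (\<lambda>y. a \<otimes> y) ` conj_class (inv a)"
    unfolding conj_class_def image_image
    by (rule image_cong) (use a in \<open>auto simp: commutator_def m_assoc\<close>)
  moreover have "inj_on (\<lambda>y. a \<otimes> y) (conj_class (inv a))"
    by (rule inj_onI) (use a in \<open>auto simp: conj_class_def\<close>)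
  ultimately show ?thesis
    using card_conj_class_dvd[of "inv a"] a by (simp add: card_image)
qed

lemma commutator_mult_right_if_commute:
  assumes "a \<in> carrier G" "x \<in> carrier G" "y \<in> carrier G"
    and "x \<otimes> commutator G a y = commutator G a y \<otimes> x"
  shows "commutator G a (x \<otimes> y) = commutator G a x \<otimes> commutator G a y"
  using commutator_mult_right[OF assms(1-3)]
    conj_eq_self_iff[OF assms(2) commutator_closed[OF assms(1,3)]] assms(4) by metis

lemma commutators_subgroup_if_central:
  assumes cen: "derived G (carrier G) \<subseteq> centralizer (carrier G)" and a: "a \<in> carrier G"
  shows "subgroup (commutator G a ` carrier G) G"
proof (rule commutator_image_subgroup[OF a subgroup_self])
  fix x y assume xy: "x \<in> carrier G" "y \<in> carrier G"
  have "commutator G a y \<in> centralizer (carrier G)"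
    using cen commutator_in_derived[OF a xy(2)] by blast
  hence "x \<otimes> commutator G a y = commutator G a y \<otimes> x"
    using xy(1) centralizerD by metis
  thus "commutator G a (x \<otimes> y) = commutator G a x \<otimes> commutator G a y"
    by (rule commutator_mult_right_if_commute[OF a xy])
qed

lemma commutators_subgroup_if_derived_abelian:
  assumes ab: "derived G (carrier G) \<subseteq> centralizer (derived G (carrier G))"
    and a: "a \<in> carrier G"
  shows "subgroup (commutator G a ` derived G (carrier G)) G"
proof (rule commutator_image_subgroup[OF a derived_is_subgroup])
  fix x y assume xy: "x \<in> derived G (carrier G)" "y \<in> derived G (carrier G)"
  have c: "x \<in> carrier G" "y \<in> carrier G" using xy derived_in_carrier by blast+
  have "commutator G a y \<in> derived G (carrier G)"
    by (rule commutator_in_derived[OF a c(2)])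
  hence "x \<otimes> commutator G a y = commutator G a y \<otimes> x"
    using xy(1) ab centralizerD by blast
  thus "commutator G a (x \<otimes> y) = commutator G a x \<otimes> commutator G a y"
    by (rule commutator_mult_right_if_commute[OF a c])
qed simp

section \<open>Derived subgroups of prime order\<close>

text \<open>If \<open>G'\<close> is central, any \<open>a\<close> outside the centre works, by the subgroup \<open>[a, G]\<close>; otherwise
  any \<open>a\<close> that does not centralize \<open>G'\<close> works, by the subgroup \<open>[a, G']\<close>.\<close>

lemma prime_derived_covered_by_one_element:
  assumes q: "Factorial_Ring.prime (card (derived G (carrier G)))"
  shows "\<exists>a \<in> carrier G. derived G (carrier G) \<subseteq> commutator G a ` carrier G"
proof -
  let ?K = "derived G (carrier G)"
  have Ksub: "subgroup ?K G" by (simp add: derived_is_subgroup)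
  have Kc: "?K \<subseteq> carrier G" by (simp add: derived_in_carrier)
  show ?thesis
  proof (cases "?K \<subseteq> centralizer (carrier G)")
    case True
    have "\<exists>a x. a \<in> carrier G \<and> x \<in> carrier G \<and> commutator G a x \<noteq> \<one>"
    proof (rule ccontr)
      assume "\<not> ?thesis"
      hence "?K \<subseteq> {\<one>}"
        by (intro derived_subset_of_commutators triv_subgroup) auto
      hence "?K = {\<one>}" using subgroup.one_closed[OF Ksub] by blast
      hence "card ?K = 1" by simp
      thus False using q by (metis not_prime_1)
    qed
    then obtain a x where ax: "a \<in> carrier G" "x \<in> carrier G" "commutator G a x \<noteq> \<one>"
      by blast
    have "commutator G a ` carrier G \<subseteq> ?K"
      using ax commutator_in_derived by blast
    hence "commutator G a ` carrier G = ?K"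
      by (rule subgroup_of_prime_card[OF commutators_subgroup_if_central[OF True ax(1)] Ksub _ q _ ax(3)])
        (use ax in blast)
    thus ?thesis using ax by blast
  next
    case False
    then obtain k a where ka: "k \<in> ?K" "a \<in> carrier G" "a \<otimes> k \<noteq> k \<otimes> a"
      using Kc unfolding centralizer_def by fastforce
    have kc: "k \<in> carrier G" using ka Kc by blast
    have ne: "commutator G a k \<noteq> \<one>" using commutator_eq_one_iff[OF ka(2) kc] ka by simp
    have abel: "?K \<subseteq> centralizer ?K"
    proof
      fix x assume x: "x \<in> ?K"
      show "x \<in> centralizer ?K"
        using commute_if_prime_card[OF Ksub q x] x Kc unfolding centralizer_def by blast
    qed
    have "commutator G a ` ?K \<subseteq> ?K"
      using ka Kc commutator_in_derived by blast
    hence "commutator G a ` ?K = ?K"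
      by (rule subgroup_of_prime_card[OF commutators_subgroup_if_derived_abelian[OF abel ka(2)] Ksub _ q _ ne])
        (use ka in blast)
    thus ?thesis using ka Kc by blast
  qed
qed

end

section \<open>Derived subgroups of order \<open>p\<^sup>2\<close>\<close>

text \<open>A finite group whose order has no prime divisor below the prime \<open>p\<close>. The prime
  \<open>p\<close> itself is not required to divide the order.\<close>

locale group_no_prime_below = group G for G (structure) +
  fixes p :: nat
  assumes finite_carrier: "finite (carrier G)"
    and prime_p: "Factorial_Ring.prime p"
    and least: "\<And>q :: nat. Factorial_Ring.prime q \<Longrightarrow> q dvd order G \<Longrightarrow> p \<le> q"
begin

abbreviation K :: "'a set" where "K \<equiv> derived G (carrier G)"

lemma K_subgroup: "subgroup K G"
  by (simp add: derived_is_subgroup)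

lemma K_carrier: "x \<in> K \<Longrightarrow> x \<in> carrier G"
  using K_subgroup by (rule subgroup.mem_carrier)

lemma finite_K: "finite K"
  using finite_carrier derived_in_carrier[of "carrier G"] finite_subset by blast

lemma small_divisor_eq_one:
  assumes "n dvd order G" "n < p"
  shows "n = 1"
proof (rule ccontr)
  assume "n \<noteq> 1"
  then obtain q where q: "Factorial_Ring.prime q" "q dvd n"
    using prime_factor_nat by blast
  have "order G > 0" using finite_carrier order_gt_0_iff_finite by blast
  hence "n > 0" using assms(1) dvd_pos_nat by blast
  hence "q \<le> n" using q by (simp add: dvd_imp_le)
  moreover have "p \<le> q" using least q assms(1) dvd_trans by blast
  ultimately show False using assms(2) by simp
qed

text \<open>A nontrivial element of such a subgroup has fewer than \<open>p\<close> conjugates, and their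
  number divides the order of the group; so it is \<open>1\<close>.\<close>

lemma normal_of_card_p_central:
  assumes N: "subgroup N G" "card N = p"
    and norm: "\<And>g n. g \<in> carrier G \<Longrightarrow> n \<in> N \<Longrightarrow> g \<otimes> n \<otimes> inv g \<in> N"
  shows "N \<subseteq> centralizer (carrier G)"
proof
  fix n assume n: "n \<in> N"
  have nc: "n \<in> carrier G" using N(1) n by (rule subgroup.mem_carrier)
  have finN: "finite N" using N(2) prime_p by (metis card.infinite not_prime_0)
  show "n \<in> centralizer (carrier G)"
  proof (cases "n = \<one>")
    case True
    thus ?thesis by (simp add: centralizer_def)
  next
    case False
    have "\<one> \<notin> conj_class n"
    proof
      assume "\<one> \<in> conj_class n"
      then obtain g where g: "g \<in> carrier G" "\<one> = g \<otimes> n \<otimes> inv g"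
        unfolding conj_class_def by blast
      have "inv g \<otimes> (g \<otimes> n \<otimes> inv g) \<otimes> g = n"
        using g(1) nc by (simp add: m_assoc inv_cancel_left)
      thus False using g False by (metis inv_closed l_inv r_one)
    qed
    hence "conj_class n \<subset> N"
      using norm n subgroup.one_closed[OF N(1)] unfolding conj_class_def by blast
    hence "card (conj_class n) < p" using psubset_card_mono[OF finN] N(2) by metis
    thus ?thesis
      using central_if_card_conj_class_one[OF nc]
        small_divisor_eq_one[OF card_conj_class_dvd[OF nc]] by blast
  qed
qed

end

text \<open>The setting of a proof by contradiction: no single element \<open>a\<close> has
  \<open>{[a, x] | x \<in> G} = G'\<close>, although \<open>G'\<close> has order \<open>p\<^sup>2\<close>.\<close>

locale no_covering_element = group_no_prime_below G p for G (structure) and p +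
  assumes card_K: "card (derived G (carrier G)) = p ^ 2"
    and no_cover: "\<And>a. a \<in> carrier G \<Longrightarrow> commutator G a ` carrier G \<noteq> derived G (carrier G)"
begin

abbreviation C :: "'a set" where "C \<equiv> centralizer K"

lemma p_gt_1: "p > 1"
  using prime_p by (rule prime_gt_1_nat)

lemma commutators_subset_K:
  assumes "a \<in> carrier G"
  shows "commutator G a ` carrier G \<subseteq> K"
  using assms commutator_in_derived by blast

lemma card_commutators_less:
  assumes "a \<in> carrier G"
  shows "card (commutator G a ` carrier G) < p ^ 2"
  using psubset_card_mono[OF finite_K] commutators_subset_K[OF assms] no_cover[OF assms] card_K
  by (metis psubsetI)

lemma K_abelian: "K \<subseteq> C"
proof
  fix x assume x: "x \<in> K"
  interpret K: group "G\<lparr>carrier := K\<rparr>"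
    using K_subgroup by (rule subgroup.subgroup_is_group) (rule is_group)
  have ord: "order (G\<lparr>carrier := K\<rparr>) = p ^ 2" using card_K by (simp add: order_def)
  have "x \<otimes> y = y \<otimes> x" if "y \<in> K" for y
    using K.commute_if_order_prime_square[OF prime_p ord, of x y] x that by simp
  thus "x \<in> C" using x K_carrier unfolding centralizer_def by blast
qed

lemma commute_K:
  assumes "x \<in> K" "y \<in> K"
  shows "x \<otimes> y = y \<otimes> x"
  using assms K_abelian unfolding centralizer_def by blast

lemma subgroup_of_K_card:
  assumes H: "subgroup H G" "H \<subseteq> K" "H \<noteq> K" "h \<in> H" "h \<noteq> \<one>"
  shows "card H = p"
proof -
  have "card H dvd p ^ 2" using card_subgroup_dvd[OF H(1) K_subgroup H(2)] card_K by simp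
  then obtain i where i: "i \<le> 2" "card H = p ^ i"
    using divides_primepow_nat[OF prime_p] by blast
  have "i \<noteq> 0"
  proof
    assume "i = 0"
    hence "card H = 1" using i by simp
    thus False using H(4,5) subgroup.one_closed[OF H(1)] by (metis card_1_singletonE singletonD)
  qed
  moreover have "i \<noteq> 2"
    using i H(2,3) card_K finite_K by (metis card_subset_eq)
  ultimately have "i = 1" using i(1) by linarith
  thus ?thesis using i by simp
qed

lemma subgroups_of_card_p_eq:
  assumes "subgroup A G" "subgroup B G" "card A = p" "card B = p"
    and "h \<in> A" "h \<in> B" "h \<noteq> \<one>"
  shows "A = B"
proof -
  have sub: "subgroup (A \<inter> B) G" using assms by (simp add: subgroups_Inter_pair)
  have "A \<inter> B = A"
    by (rule subgroup_of_prime_card[OF sub assms(1), of h]) (use assms prime_p in auto)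
  moreover have "A \<inter> B = B"
    by (rule subgroup_of_prime_card[OF sub assms(2), of h]) (use assms prime_p in auto)
  ultimately show ?thesis by simp
qed

lemma not_all_commutators_in_card_p:
  assumes "subgroup A G" "card A = p"
    and "\<And>x y. x \<in> carrier G \<Longrightarrow> y \<in> carrier G \<Longrightarrow> commutator G x y \<in> A"
  shows False
proof -
  have "K \<subseteq> A" using derived_subset_of_commutators[OF assms(1)] assms(3) by blast
  moreover have "finite A" using assms(2) p_gt_1 card.infinite by fastforce
  ultimately have "p ^ 2 \<le> p" using card_mono assms(2) card_K by metis
  thus False using p_gt_1 by (simp add: power2_eq_square)
qed

text \<open>When \<open>G'\<close> is central, each \<open>[a, G]\<close> is a subgroup of order \<open>1\<close> or \<open>p\<close>. If
  \<open>[a, G]\<close> and \<open>[b, G]\<close> are nontrivial and distinct, an \<open>x\<close> commuting with neither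
  \<open>a\<close> nor \<open>b\<close> would give \<open>[a, G] = [x, G] = [b, G]\<close>; so \<open>G\<close> would be the union of the
  two proper subgroups centralizing \<open>a\<close> and \<open>b\<close>.\<close>

lemma not_central: "\<not> K \<subseteq> centralizer (carrier G)"
proof
  assume cen: "K \<subseteq> centralizer (carrier G)"
  define R where "R a = commutator G a ` carrier G" for a
  have R_sub: "subgroup (R a) G" if "a \<in> carrier G" for a
    unfolding R_def using commutators_subgroup_if_central[OF cen that] .
  have R_card: "card (R a) = p"
    if "a \<in> carrier G" "x \<in> carrier G" "commutator G a x \<noteq> \<one>" for a x
    using subgroup_of_K_card[OF R_sub[OF that(1)], of "commutator G a x"]
      commutators_subset_K[OF that(1)] no_cover[OF that(1)] that unfolding R_def by blast
  have link: "R x = R a"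
    if a: "a \<in> carrier G" and x: "x \<in> carrier G" and ne: "commutator G a x \<noteq> \<one>" for a x
  proof -
    have inv: "inv (commutator G a x) = commutator G x a" by (rule inv_commutator[OF a x])
    have ne': "commutator G x a \<noteq> \<one>"
      using ne a x by (simp add: commutator_eq_one_iff)
    have "commutator G a x \<in> R a" using x by (simp add: R_def)
    hence "commutator G x a \<in> R a"
      using subgroup.m_inv_closed[OF R_sub[OF a]] inv by metis
    moreover have "commutator G x a \<in> R x" using a by (simp add: R_def)
    ultimately show ?thesis
      using subgroups_of_card_p_eq[OF R_sub[OF x] R_sub[OF a] R_card[OF x a ne'] R_card[OF a x ne]]
        ne' by blast
  qed
  have mult: "commutator G a (x \<otimes> y) = commutator G a x \<otimes> commutator G a y"
    if "a \<in> carrier G" "x \<in> carrier G" "y \<in> carrier G" for a x y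
  proof (rule commutator_mult_right_if_commute[OF that])
    have "commutator G a y \<in> centralizer (carrier G)"
      using cen commutator_in_derived that by blast
    thus "x \<otimes> commutator G a y = commutator G a y \<otimes> x"
      using that by (simp add: centralizer_def)
  qed
  have "\<exists>a x. a \<in> carrier G \<and> x \<in> carrier G \<and> commutator G a x \<noteq> \<one>"
  proof (rule ccontr)
    assume "\<not> ?thesis"
    hence "K \<subseteq> {\<one>}"
      by (intro derived_subset_of_commutators triv_subgroup) auto
    hence "card K \<le> 1" using card_mono[of "{\<one>}" K] by simp
    thus False using card_K one_less_power[OF p_gt_1, of 2] by simp
  qed
  then obtain a x where ax: "a \<in> carrier G" "x \<in> carrier G" "commutator G a x \<noteq> \<one>"
    by blast
  obtain b y where by': "b \<in> carrier G" "y \<in> carrier G" "commutator G b y \<notin> R a"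
    using not_all_commutators_in_card_p[OF R_sub[OF ax(1)] R_card[OF ax]] by blast
  have ne: "commutator G b y \<noteq> \<one>"
    using by'(3) subgroup.one_closed[OF R_sub[OF ax(1)]] by metis
  have diff: "R a \<noteq> R b" using by' by (auto simp: R_def)
  \<comment> \<open>No single element can fail to commute with \<open>a\<close> and also with \<open>b\<close>, but
    \<open>x \<otimes> y\<close> does.\<close>
  have bx: "commutator G b x = \<one>" using link[OF ax] link[OF by'(1) ax(2)] diff by metis
  have ay: "commutator G a y = \<one>" using link[OF by'(1,2) ne] link[OF ax(1) by'(2)] diff by metis
  have xy: "x \<otimes> y \<in> carrier G" using ax by' by simp
  have "commutator G a (x \<otimes> y) \<noteq> \<one>" using mult[OF ax(1,2) by'(2)] ay ax by simp
  moreover have "commutator G b (x \<otimes> y) \<noteq> \<one>"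
    using mult[OF by'(1) ax(2) by'(2)] bx ne by' by simp
  ultimately show False
    using link[OF ax(1) xy] link[OF by'(1) xy] diff by metis
qed

lemma conj_K:
  assumes "g \<in> carrier G" "k \<in> K"
  shows "g \<otimes> k \<otimes> inv g \<in> K"
  using normal.inv_op_closed2[OF derived_self_is_normal] assms by blast

text \<open>The set \<open>[a, G']\<close> of commutators of \<open>a\<close> with elements of \<open>G'\<close>; it is a subgroup because
  \<open>G'\<close> is abelian.\<close>

definition A :: "'a \<Rightarrow> 'a set" where
  "A a = commutator G a ` K"

lemma A_subgroup:
  assumes "a \<in> carrier G"
  shows "subgroup (A a) G"
  unfolding A_def using commutators_subgroup_if_derived_abelian[OF K_abelian assms] .

lemma A_subset:
  assumes "a \<in> carrier G"
  shows "A a \<subseteq> commutator G a ` carrier G"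
  using K_carrier by (auto simp: A_def)

lemma A_card:
  assumes a: "a \<in> carrier G" "a \<notin> C"
  shows "card (A a) = p"
proof -
  obtain k where k: "k \<in> K" "a \<otimes> k \<noteq> k \<otimes> a"
    using a by (auto simp: centralizer_def)
  have ne: "commutator G a k \<noteq> \<one>"
    using commutator_eq_one_iff[OF a(1) K_carrier[OF k(1)]] k by simp
  have "A a \<subseteq> K" "A a \<noteq> K"
    using A_subset[OF a(1)] commutators_subset_K[OF a(1)] no_cover[OF a(1)] by blast+
  thus ?thesis
    using subgroup_of_K_card[OF A_subgroup[OF a(1)], of "commutator G a k"] ne k
    by (simp add: A_def)
qed

text \<open>The set \<open>[a, G]\<close> is a union of cosets of \<open>[a, G']\<close>, and its
  cardinality is the size of a conjugacy class; so that cardinality is \<open>p * m\<close>, where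
  \<open>m < p\<close> divides the order of the group.\<close>

lemma commutators_eq_A:
  assumes a: "a \<in> carrier G" "a \<notin> C"
  shows "commutator G a ` carrier G = A a"
proof -
  let ?R = "commutator G a ` carrier G"
  let ?Q = "(\<lambda>r. A a #> r) ` ?R"
  have R_carrier: "?R \<subseteq> carrier G" using a by auto
  have A_carrier: "A a \<subseteq> carrier G" using A_subgroup[OF a(1)] by (rule subgroup.subset)
  have finR: "finite ?R" using finite_carrier by simp
  have shift: "commutator G a k \<otimes> commutator G a x \<in> ?R"
    if k: "k \<in> K" and x: "x \<in> carrier G" for k x
  proof -
    have kc: "k \<in> carrier G" using k by (rule K_carrier)
    have axK: "commutator G a x \<in> K" using a x commutator_in_derived by blast
    have "commutator G a (k \<otimes> x) = commutator G a k \<otimes> commutator G a x"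
      by (rule commutator_mult_right_if_commute[OF a(1) kc x commute_K[OF k axK]])
    thus ?thesis using kc x by (metis image_eqI m_closed)
  qed
  have union: "\<Union> ?Q = ?R"
  proof
    show "\<Union> ?Q \<subseteq> ?R"
      using shift by (auto simp: r_coset_def A_def)
    show "?R \<subseteq> \<Union> ?Q"
      using rcos_self[OF _ A_subgroup[OF a(1)]] R_carrier by blast
  qed
  have rc: "?Q \<subseteq> rcosets (A a)" using R_carrier by (auto simp: RCOSETS_def)
  have "p dvd card (\<Union> ?Q)"
  proof (rule dvd_partition)
    show "finite (\<Union> ?Q)" using union finR by simp
    show "\<forall>c\<in>?Q. p dvd card c"
    proof
      fix c assume "c \<in> ?Q"
      hence "c \<in> rcosets (A a)" using rc by blast
      hence "card c = p" using card_rcosets_equal[OF _ A_carrier] A_card[OF a] by simp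
      thus "p dvd card c" by simp
    qed
    show "\<forall>c1\<in>?Q. \<forall>c2\<in>?Q. c1 \<noteq> c2 \<longrightarrow> c1 \<inter> c2 = {}"
      using rcos_disjoint[OF A_subgroup[OF a(1)]] rc unfolding pairwise_def disjnt_def by blast
  qed
  then obtain m where m: "card ?R = p * m" using union by (metis dvdE)
  have "m < p" using card_commutators_less[OF a(1)] m p_gt_1 by (simp add: power2_eq_square)
  moreover have "m dvd order G"
    using card_commutators_dvd[OF a(1)] m by (metis dvd_mult_right)
  ultimately have "card ?R = p" using small_divisor_eq_one m by simp
  thus ?thesis
    using A_subset[OF a(1)] A_card[OF a] finR by (metis card_subset_eq)
qed

text \<open>Conjugation multiplies \<open>a\<close> by an element of the abelian group \<open>G'\<close>, which does not
  change \<open>[a, k]\<close> for \<open>k\<close> in \<open>G'\<close>. So \<open>[a, G']\<close> is normal, of order \<open>p\<close>.\<close>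

lemma A_central:
  assumes a: "a \<in> carrier G" "a \<notin> C"
  shows "A a \<subseteq> centralizer (carrier G)"
proof (rule normal_of_card_p_central[OF A_subgroup[OF a(1)] A_card[OF a]])
  fix g n assume g: "g \<in> carrier G" and n: "n \<in> A a"
  obtain k where k: "k \<in> K" "n = commutator G a k" using n by (auto simp: A_def)
  have kc: "k \<in> carrier G" using k(1) by (rule K_carrier)
  let ?k = "g \<otimes> k \<otimes> inv g" and ?c = "commutator G g a"
  have k': "?k \<in> K" "?k \<in> carrier G" using conj_K[OF g k(1)] K_carrier by auto
  have c: "?c \<in> K" "?c \<in> carrier G" using commutator_in_derived[OF g a(1)] K_carrier by auto
  have ak: "commutator G a ?k \<in> K" "commutator G a ?k \<in> carrier G"
    using commutator_in_derived[OF a(1) k'(2)] K_carrier by auto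
  have "g \<otimes> a \<otimes> inv g = ?c \<otimes> a" using g a by (simp add: group_word_simps)
  hence "g \<otimes> n \<otimes> inv g = commutator G (?c \<otimes> a) ?k"
    using conj_commutator[OF g a(1) kc] k(2) by simp
  also have "\<dots> = (?c \<otimes> commutator G a ?k \<otimes> inv ?c) \<otimes> commutator G ?c ?k"
    by (rule commutator_mult_left[OF c(2) a(1) k'(2)])
  also have "?c \<otimes> commutator G a ?k \<otimes> inv ?c = commutator G a ?k"
    using conj_eq_self_iff[OF c(2) ak(2)] commute_K[OF c(1) ak(1)] by blast
  also have "commutator G ?c ?k = \<one>"
    using commutator_eq_one_iff[OF c(2) k'(2)] commute_K[OF c(1) k'(1)] by blast
  finally show "g \<otimes> n \<otimes> inv g \<in> A a" using k'(1) ak(2) by (simp add: A_def)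
qed

text \<open>Two different subgroups \<open>[a, G']\<close> and \<open>[b, G']\<close> would generate \<open>G'\<close>, making it
  central.\<close>

lemma A_unique:
  assumes a: "a \<in> carrier G" "a \<notin> C" and b: "b \<in> carrier G" "b \<notin> C"
  shows "A a = A b"
proof (rule ccontr)
  assume neq: "A a \<noteq> A b"
  let ?Z = "centralizer (carrier G) \<inter> K"
  have Zsub: "subgroup ?Z G"
    using centralizer_subgroup[of "carrier G"] K_subgroup by (simp add: subgroups_Inter_pair)
  have AZ: "A a \<subseteq> ?Z" "A b \<subseteq> ?Z"
    using A_central[OF a] A_central[OF b] A_subset commutators_subset_K a b by blast+
  have fin: "finite ?Z" using finite_K by simp
  have "A a \<noteq> {\<one>}" using A_card[OF a] p_gt_1 by auto
  then obtain s where s: "s \<in> A a" "s \<noteq> \<one>"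
    using subgroup.one_closed[OF A_subgroup[OF a(1)]] by blast
  have "?Z \<noteq> K" using not_central by blast
  hence "card ?Z = p"
    using subgroup_of_K_card[OF Zsub _ _ _ s(2)] s(1) AZ(1) by blast
  hence "A a = ?Z" "A b = ?Z"
    using AZ A_card[OF a] A_card[OF b] fin by (metis card_subset_eq)+
  thus False using neq by simp
qed

text \<open>The common subgroup \<open>[a, G']\<close> contains every commutator with an entry outside \<open>C\<close>,
  and then also the commutators with both entries in \<open>C\<close>.\<close>

lemma contradiction: False
proof -
  have Csub: "subgroup C G"
    using centralizer_subgroup derived_in_carrier by blast
  obtain a where a: "a \<in> carrier G" "a \<notin> C"
  proof (rule ccontr)
    assume "\<not> thesis"
    hence "carrier G \<subseteq> C" using that by blast
    hence "K \<subseteq> centralizer (carrier G)"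
      using K_carrier centralizerD by (fastforce simp: centralizer_def)
    thus False using not_central by contradiction
  qed
  have in_A: "commutator G x y \<in> A a"
    if "x \<in> carrier G" "x \<notin> C" "y \<in> carrier G" for x y
    using commutators_eq_A[OF that(1,2)] A_unique[OF that(1,2) a] that(3) by blast
  have in_A': "commutator G x y \<in> A a"
    if "y \<in> carrier G" "y \<notin> C" "x \<in> carrier G" for x y
    using subgroup.m_inv_closed[OF A_subgroup[OF a(1)] in_A[OF that]] inv_commutator[OF that(1,3)]
    by simp
  have "commutator G x y \<in> A a" if x: "x \<in> carrier G" and y: "y \<in> carrier G" for x y
  proof (cases "y \<in> C")
    case False
    thus ?thesis using in_A' x y by blast
  next
    case True
    \<comment> \<open>The product \<open>y \<otimes> a\<close> lies outside \<open>C\<close>, and \<open>[x, y \<otimes> a] = [x, y] \<otimes> [x, a]\<close>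
      because \<open>y\<close> centralizes \<open>[x, a]\<close>.\<close>
    have ya: "y \<otimes> a \<in> carrier G" using y a by simp
    have "y \<otimes> a \<notin> C"
    proof
      assume "y \<otimes> a \<in> C"
      hence "inv y \<otimes> (y \<otimes> a) \<in> C"
        using Csub True by (simp add: subgroup.m_closed subgroup.m_inv_closed)
      thus False using a y by (simp add: inv_cancel_left)
    qed
    hence 1: "commutator G x (y \<otimes> a) \<in> A a" using in_A' ya x by blast
    have xa: "commutator G x a \<in> A a" using in_A' a x by blast
    have "y \<otimes> commutator G x a = commutator G x a \<otimes> y"
      using True commutator_in_derived[OF x a(1)] by (simp add: centralizer_def)
    hence "commutator G x (y \<otimes> a) = commutator G x y \<otimes> commutator G x a"
      by (rule commutator_mult_right_if_commute[OF x y a(1)])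
    hence "commutator G x y = commutator G x (y \<otimes> a) \<otimes> inv (commutator G x a)"
      using x y a ya by (simp add: inv_solve_right)
    thus ?thesis
      using subgroup.m_closed[OF A_subgroup[OF a(1)] 1 subgroup.m_inv_closed[OF A_subgroup[OF a(1)] xa]]
      by simp
  qed
  thus False
    using not_all_commutators_in_card_p[OF A_subgroup[OF a(1)] A_card[OF a]] by blast
qed

end

section \<open>The general case\<close>

context group_no_prime_below
begin

text \<open>An integer \<open>n \<le> p\<^sup>2\<close> without prime factors below \<open>p\<close> is \<open>1\<close>, a prime or \<open>p\<^sup>2\<close>.\<close>

lemma divisor_le_square_cases:
  assumes "n dvd order G" "n \<le> p ^ 2"
  shows "n = 1 \<or> Factorial_Ring.prime n \<or> n = p ^ 2"
proof (rule ccontr)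
  assume neg: "\<not> ?thesis"
  then obtain q where q: "Factorial_Ring.prime q" "q dvd n"
    using prime_factor_nat by blast
  then obtain m where m: "n = q * m" by (elim dvdE)
  have "m \<noteq> 1" using neg q m by auto
  moreover have "m dvd order G" using m assms(1) dvd_mult_right by metis
  ultimately have "p \<le> m" using small_divisor_eq_one not_le by blast
  moreover have "p \<le> q" using least q assms(1) dvd_trans by blast
  ultimately have "p ^ 2 \<le> n" unfolding m power2_eq_square by (rule mult_le_mono[rotated])
  thus False using assms(2) neg by simp
qed

text \<open>A single element \<open>a\<close> suffices to write all elements of \<open>G'\<close> as \<open>[a, x]\<close>.\<close>

lemma derived_covered_by_one_element:
  assumes "card K \<le> p ^ 2"
  shows "\<exists>a \<in> carrier G. K \<subseteq> commutator G a ` carrier G"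
proof -
  have "card K dvd order G"
    using card_subgroup_dvd[OF K_subgroup subgroup_self derived_in_carrier]
    by (simp add: order_def)
  then consider "card K = 1" | "Factorial_Ring.prime (card K)" | "card K = p ^ 2"
    using divisor_le_square_cases assms by blast
  thus ?thesis
  proof cases
    case 1
    hence "K = {\<one>}"
      using subgroup.one_closed[OF K_subgroup] by (metis card_1_singletonE singletonD)
    moreover have "commutator G \<one> \<one> = \<one>" by (simp add: commutator_eq_one_iff)
    ultimately show ?thesis by (metis empty_subsetI image_eqI insert_subset one_closed)
  next
    case 2
    thus ?thesis by (rule prime_derived_covered_by_one_element)
  next
    case 3
    show ?thesis
    proof (rule ccontr)
      assume neg: "\<not> ?thesis"
      interpret no_covering_element G p
        by unfold_locales (use 3 neg in auto)
      show False by (rule contradiction)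
    qed
  qed
qed

end

theorem proposition5p3p3:
  fixes G :: "('a, 'b) monoid_scheme" and p :: nat
  assumes "group G"
    and "finite (carrier G)"
    and "Factorial_Ring.prime p"
    and "p dvd order G"
    and "\<And>q :: nat. Factorial_Ring.prime q \<Longrightarrow> q dvd order G \<Longrightarrow> p \<le> q"
    and "card (derived G (carrier G)) \<le> p ^ 2"
  shows "\<forall>g \<in> derived G (carrier G).
           \<exists>x \<in> carrier G. \<exists>y \<in> carrier G. g = commutator G x y"
proof -
  interpret group_no_prime_below G p
    using assms(1) by (rule group_no_prime_below.intro)
      (unfold_locales, use assms(2,3,5) in auto)
  show ?thesis using derived_covered_by_one_element[OF assms(6)] by blast
qed

end
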